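(* Let $(G,c)$ be a resistance network with vertex set $V$ and reference vertex $o$. For all $u\in\mathrm{Harm}$ (and $x\in V$), $$u(x)=\sum_{\mathrm{bd}\,G}u\,\frac{\partial h_x}{\partial n}+u(o).$$
   Context: A resistance network $(G,c)$ is a connected graph with vertex set $V$ and a conductance function $c_{xy}=c_{yx}\in[0,\infty)$ with $c_{xx}=0$, where $x\sim y$ (adjacency) iff $c_{xy}>0$, and $c(x):=\sum_{y\sim x}c_{xy}<\infty$ for every $x\in V$. Fix a reference vertex $o\in V$. The Laplacian is $(\Delta v)(x)=\sum_{y\sim x}c_{xy}(v(x)-v(y))$. The energy form is $\mathcal E(u,v)=\frac12\sum_{x,y\in V}c_{xy}\overline{(u(x)-u(y))}(v(x)-v(y))$, and $\mathrm{dom}\,\mathcal E$ is the set of functions $u$ on $V$ with $\mathcal E(u,u)<\infty$. The energy Hilbert space $\mathcal H_{\mathcal E}$ is the completion of $\mathrm{dom}\,\mathcal E$ modulo constant functions, with inner product $\langle u,v\rangle_{\mathcal E}=\mathcal E(u,v)$; its elements are classes of functions on $V$ modulo constants. When values of $u$ are written, any representative may be used (the same one throughout the formula). For $x\in V$, $v_x\in\mathcal H_{\mathcal E}$ is the unique element with $\langle v_x,u\rangle_{\mathcal E}=u(x)-u(o)$ for all $u\in\mathcal H_{\mathcal E}$. $\mathrm{Harm}=\{u\in\mathcal H_{\mathcal E}:\Delta u(x)=0\text{ for all }x\in V\}$, and $h_x$ is the orthogonal projection of $v_x$ to $\mathrm{Harm}$. An exhaustion of $G$ is an increasing sequence of finite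 connected subgraphs $G_k$ with $\bigcup_kG_k=G$. For a subgraph $H$, $\mathrm{bd}\,H=\{x\in H:\exists y\notin H,\ y\sim x\}$, and for $x\in\mathrm{bd}\,H$ the normal derivative is $\frac{\partial v}{\partial n}(x)=\sum_{y\in H}c_{xy}(v(x)-v(y))$. The boundary sum is $\sum_{\mathrm{bd}\,G}u\frac{\partial v}{\partial n}:=\lim_{k\to\infty}\sum_{y\in\mathrm{bd}\,G_k}u(y)\frac{\partial v}{\partial n}(y)$ (normal derivatives with respect to $G_k$), whenever the limit is independent of the choice of exhaustion. *)

theory Defs
  imports "HOL-Analysis.Analysis"
begin

text \<open>
  The vertex set is the whole type \<open>'v\<close>; a network is given by its conductance function
  \<open>c\<close>. Vertices may have infinite degree.
\<close>

definition adj :: "('v \<Rightarrow> 'v \<Rightarrow> real) \<Rightarrow> 'v \<Rightarrow> 'v \<Rightarrow> bool" where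
  "adj c x y \<longleftrightarrow> c x y > 0"

definition connected_verts :: "('v \<Rightarrow> 'v \<Rightarrow> real) \<Rightarrow> 'v set \<Rightarrow> bool" where
  "connected_verts c H \<longleftrightarrow> H \<noteq> {} \<and>
     (\<forall>x\<in>H. \<forall>y\<in>H. (\<lambda>a b. a \<in> H \<and> b \<in> H \<and> adj c a b)\<^sup>*\<^sup>* x y)"

definition resistance_network :: "('v \<Rightarrow> 'v \<Rightarrow> real) \<Rightarrow> bool" where
  "resistance_network c \<longleftrightarrow>
     (\<forall>x y. c x y = c y x) \<and> (\<forall>x y. 0 \<le> c x y) \<and> (\<forall>x. c x x = 0) \<and>
     connected_verts c UNIV \<and>
     (\<forall>x. (\<lambda>y. c x y) summable_on {y. adj c x y})"

subsection \<open>Functions modulo constants\<close>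

definition eq_mod_const :: "('v \<Rightarrow> complex) \<Rightarrow> ('v \<Rightarrow> complex) \<Rightarrow> bool" where
  "eq_mod_const u v \<longleftrightarrow> (\<exists>k. \<forall>x. u x = v x + k)"

quotient_type 'v pot = "'v \<Rightarrow> complex" / eq_mod_const
  morphisms rep_pot class_of
proof (rule equivpI)
  show "reflp eq_mod_const"
    by (auto simp: reflp_def eq_mod_const_def intro: exI[of _ 0])
  show "symp eq_mod_const"
  proof (rule sympI)
    fix u v :: "'a \<Rightarrow> complex"
    assume "eq_mod_const u v"
    then obtain k where "\<forall>x. u x = v x + k" by (auto simp: eq_mod_const_def)
    then show "eq_mod_const v u"
      unfolding eq_mod_const_def by (intro exI[of _ "- k"]) simp
  qed
  show "transp eq_mod_const"
  proof (rule transpI)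
    fix u v w :: "'a \<Rightarrow> complex"
    assume "eq_mod_const u v" "eq_mod_const v w"
    then obtain k l where "\<forall>x. u x = v x + k" "\<forall>x. v x = w x + l"
      by (auto simp: eq_mod_const_def)
    then show "eq_mod_const u w"
      unfolding eq_mod_const_def by (intro exI[of _ "l + k"]) (simp add: add.assoc)
  qed
qed

instantiation pot :: (type) ab_group_add
begin

lift_definition zero_pot :: "'a pot" is "\<lambda>x. 0" .

lift_definition plus_pot :: "'a pot \<Rightarrow> 'a pot \<Rightarrow> 'a pot" is "\<lambda>u v x. u x + v x"
proof -
  fix u u' v v' :: "'a \<Rightarrow> complex"
  assume "eq_mod_const u u'" "eq_mod_const v v'"
  then obtain k l where "\<forall>x. u x = u' x + k" "\<forall>x. v x = v' x + l"
    by (auto simp: eq_mod_const_def)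
  then show "eq_mod_const (\<lambda>x. u x + v x) (\<lambda>x. u' x + v' x)"
    unfolding eq_mod_const_def by (intro exI[of _ "k + l"]) simp
qed

lift_definition uminus_pot :: "'a pot \<Rightarrow> 'a pot" is "\<lambda>u x. - u x"
proof -
  fix u u' :: "'a \<Rightarrow> complex"
  assume "eq_mod_const u u'"
  then obtain k where "\<forall>x. u x = u' x + k"
    by (auto simp: eq_mod_const_def)
  then show "eq_mod_const (\<lambda>x. - u x) (\<lambda>x. - u' x)"
    unfolding eq_mod_const_def by (intro exI[of _ "- k"]) simp
qed

lift_definition minus_pot :: "'a pot \<Rightarrow> 'a pot \<Rightarrow> 'a pot" is "\<lambda>u v x. u x - v x"
proof -
  fix u u' v v' :: "'a \<Rightarrow> complex"
  assume "eq_mod_const u u'" "eq_mod_const v v'"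
  then obtain k l where "\<forall>x. u x = u' x + k" "\<forall>x. v x = v' x + l"
    by (auto simp: eq_mod_const_def)
  then show "eq_mod_const (\<lambda>x. u x - v x) (\<lambda>x. u' x - v' x)"
    unfolding eq_mod_const_def by (intro exI[of _ "k - l"]) simp
qed

instance
proof
  fix a b d :: "'a pot"
  show "a + b + d = a + (b + d)"
    by transfer (auto simp: eq_mod_const_def intro: exI[of _ 0])
  show "a + b = b + a"
    by transfer (auto simp: eq_mod_const_def intro: exI[of _ 0])
  show "0 + a = a"
    by transfer (auto simp: eq_mod_const_def intro: exI[of _ 0])
  show "- a + a = 0"
    by transfer (auto simp: eq_mod_const_def intro: exI[of _ 0])
  show "a - b = a + - b"
    by transfer (auto simp: eq_mod_const_def intro: exI[of _ 0])
qed

end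

lift_definition val_diff :: "'v pot \<Rightarrow> 'v \<Rightarrow> 'v \<Rightarrow> complex" is "\<lambda>u x y. u x - u y"
  by (auto simp: eq_mod_const_def)

lift_definition laplacian :: "('v \<Rightarrow> 'v \<Rightarrow> real) \<Rightarrow> 'v pot \<Rightarrow> 'v \<Rightarrow> complex" is
  "\<lambda>c u x. \<Sum>\<^sub>\<infinity>y\<in>{y. adj c x y}. of_real (c x y) * (u x - u y)"
  by (auto simp: eq_mod_const_def)

subsection \<open>The energy space\<close>

lift_definition energy :: "('v \<Rightarrow> 'v \<Rightarrow> real) \<Rightarrow> 'v pot \<Rightarrow> 'v pot \<Rightarrow> complex" is
  "\<lambda>c u v. 1/2 * (\<Sum>\<^sub>\<infinity>(x, y)\<in>UNIV. of_real (c x y) * cnj (u x - u y) * (v x - v y))"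
  by (auto simp: eq_mod_const_def)

definition dom_energy :: "('v \<Rightarrow> 'v \<Rightarrow> real) \<Rightarrow> ('v \<Rightarrow> complex) set" where
  "dom_energy c = {u. (\<lambda>(x, y). c x y * (cmod (u x - u y))\<^sup>2) summable_on UNIV}"

text \<open>
  \<open>dom_energy c\<close> modulo constants is already complete for the inner product \<open>energy c\<close>
  (lemma \<open>energy_space_complete\<close> below), so it is its own completion.
\<close>

definition energy_space :: "('v \<Rightarrow> 'v \<Rightarrow> real) \<Rightarrow> 'v pot set" where
  "energy_space c = class_of ` dom_energy c"

lemma dom_energy_bound:
  assumes c: "\<And>x y. 0 \<le> c x y"
    and b: "\<And>F. finite F \<Longrightarrow> (\<Sum>(x, y)\<in>F. c x y * (cmod (u x - u y))\<^sup>2) \<le> B"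
  shows "u \<in> dom_energy c"
    and "(\<Sum>\<^sub>\<infinity>(x, y)\<in>UNIV. c x y * (cmod (u x - u y))\<^sup>2) \<le> B"
proof -
  show u: "u \<in> dom_energy c"
    unfolding dom_energy_def mem_Collect_eq
    by (rule nonneg_bdd_above_summable_on) (use b c in \<open>auto simp: bdd_above_def split_beta\<close>)
  show "(\<Sum>\<^sub>\<infinity>(x, y)\<in>UNIV. c x y * (cmod (u x - u y))\<^sup>2) \<le> B"
    by (rule infsum_le_finite_sums) (use u b in \<open>auto simp: dom_energy_def\<close>)
qed

lemma dom_energy_partial_sum:
  assumes "\<And>x y. 0 \<le> c x y" "u \<in> dom_energy c" "finite F"
  shows "(\<Sum>(x, y)\<in>F. c x y * (cmod (u x - u y))\<^sup>2)
           \<le> (\<Sum>\<^sub>\<infinity>(x, y)\<in>UNIV. c x y * (cmod (u x - u y))\<^sup>2)"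
  by (rule finite_sum_le_infsum) (use assms in \<open>auto simp: dom_energy_def\<close>)

lemma infsum_complex_of_real:
  "(\<Sum>\<^sub>\<infinity>x\<in>A. complex_of_real (f x)) = of_real (infsum f A)"
proof (cases "f summable_on A")
  case True
  then show ?thesis
    by (intro infsumI has_sum_of_real has_sum_infsum)
next
  case False
  then have "\<not> (\<lambda>x. complex_of_real (f x)) summable_on A"
    using summable_on_Re[of "\<lambda>x. complex_of_real (f x)" A] by auto
  with False show ?thesis
    by (simp add: infsum_not_exists)
qed

lemma energy_self:
  "energy c (class_of u) (class_of u)
     = of_real (1/2 * (\<Sum>\<^sub>\<infinity>(x, y)\<in>UNIV. c x y * (cmod (u x - u y))\<^sup>2))"
proof -
  have "(\<lambda>(x, y). of_real (c x y) * cnj (u x - u y) * (u x - u y))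
      = (\<lambda>p. complex_of_real (case p of (x, y) \<Rightarrow> c x y * (cmod (u x - u y))\<^sup>2))"
    by (auto simp: fun_eq_iff complex_norm_square mult_ac simp del: of_real_power)
  then show ?thesis
    by (simp add: energy.abs_eq infsum_complex_of_real)
qed

lemma dom_energy_diff:
  assumes c: "\<And>x y. 0 \<le> c x y" and u: "u \<in> dom_energy c" and v: "v \<in> dom_energy c"
  shows "(\<lambda>x. u x - v x) \<in> dom_energy c"
proof -
  have le: "(cmod (a - b))\<^sup>2 \<le> 2 * (cmod a)\<^sup>2 + 2 * (cmod b)\<^sup>2" for a b :: complex
  proof -
    have "(cmod (a - b))\<^sup>2 \<le> (cmod a + cmod b)\<^sup>2"
      by (intro power_mono norm_triangle_ineq4) auto
    also have "\<dots> \<le> 2 * (cmod a)\<^sup>2 + 2 * (cmod b)\<^sup>2"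
      using zero_le_power2[of "cmod a - cmod b"] by (simp add: power2_eq_square algebra_simps)
    finally show ?thesis .
  qed
  define q where "q = (\<lambda>(u :: 'a \<Rightarrow> complex) (x, y). c x y * (cmod (u x - u y))\<^sup>2)"
  have "(\<lambda>p. 2 * q u p + 2 * q v p) summable_on UNIV"
    using u v by (intro summable_on_add summable_on_cmult_right) (auto simp: dom_energy_def q_def)
  then have "q (\<lambda>x. u x - v x) summable_on UNIV"
  proof (rule summable_on_comparison_test)
    fix p :: "'a \<times> 'a"
    obtain x y where p: "p = (x, y)" by (cases p)
    have eq: "u x - v x - (u y - v y) = (u x - u y) - (v x - v y)" by simp
    have "c x y * (cmod (u x - v x - (u y - v y)))\<^sup>2
        \<le> c x y * (2 * (cmod (u x - u y))\<^sup>2 + 2 * (cmod (v x - v y))\<^sup>2)"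
      unfolding eq by (intro mult_left_mono le c)
    then show "q (\<lambda>x. u x - v x) p \<le> 2 * q u p + 2 * q v p"
      by (simp add: q_def p algebra_simps)
    show "0 \<le> q (\<lambda>x. u x - v x) p"
      by (simp add: q_def p c)
  qed
  then show ?thesis by (simp add: dom_energy_def q_def)
qed

lemma energy_space_complete:
  assumes net: "resistance_network c"
    and U: "\<And>n. U n \<in> energy_space c"
    and Cauchy: "\<And>e. e > 0 \<Longrightarrow>
          \<exists>N. \<forall>m\<ge>N. \<forall>n\<ge>N. cmod (energy c (U m - U n) (U m - U n)) < e"
  shows "\<exists>W\<in>energy_space c. (\<lambda>n. energy c (U n - W) (U n - W)) \<longlonglongrightarrow> 0"
proof -
  define q where "q = (\<lambda>u :: 'a \<Rightarrow> complex. \<Sum>\<^sub>\<infinity>(x, y)\<in>UNIV. c x y * (cmod (u x - u y))\<^sup>2)"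
  have c: "0 \<le> c x y" for x y
    using net by (auto simp: resistance_network_def)
  have q0: "0 \<le> q u" for u
    unfolding q_def by (rule infsum_nonneg) (auto simp: c)
  obtain f where f: "f n \<in> dom_energy c" "U n = class_of (f n)" for n
    using U unfolding energy_space_def image_iff by metis
  have en: "energy c (U n - class_of w) (U n - class_of w) = of_real (q (\<lambda>x. f n x - w x) / 2)"
    for n w
    by (simp add: f minus_pot.abs_eq energy_self q_def)
  have "\<exists>N. \<forall>m\<ge>N. \<forall>n\<ge>N. q (\<lambda>x. f m x - f n x) < e" if "e > 0" for e
  proof -
    have "e / 2 > 0" using that by simp
    from Cauchy[OF this] obtain N where
      N: "\<forall>m\<ge>N. \<forall>n\<ge>N. cmod (energy c (U m - U n) (U m - U n)) < e / 2" by blast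
    have "cmod (energy c (U m - U n) (U m - U n)) = q (\<lambda>x. f m x - f n x) / 2" for m n
      unfolding f(2)[of n] en norm_of_real using q0 by simp
    with N show ?thesis by auto
  qed
  note C = this
  fix r :: 'a
  define g where "g = (\<lambda>n x. f n x - f n r)"
  have qg: "q (\<lambda>x. g n x - w x) = q (\<lambda>x. f n x - w x)" for n w
    by (simp add: q_def g_def algebra_simps)
  have gC: "Cauchy (\<lambda>n. g n x)" for x
  proof -
    have "(adj c)\<^sup>*\<^sup>* r x"
      using net by (auto simp: resistance_network_def connected_verts_def)
    then show ?thesis
    proof induction
      case base
      then show ?case by (simp add: g_def Cauchy_def)
    next
      case (step y z)
      then have pos: "c y z > 0" by (simp add: adj_def)
      have "Cauchy (\<lambda>n. f n y - f n z)"
        unfolding Cauchy_def dist_norm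
      proof (intro allI impI)
        fix e :: real assume e: "e > 0"
        with pos have "c y z * e\<^sup>2 > 0" by simp
        from C[OF this] obtain N where
          N: "\<And>m n. m \<ge> N \<Longrightarrow> n \<ge> N \<Longrightarrow> q (\<lambda>x. f m x - f n x) < c y z * e\<^sup>2" by blast
        have "cmod (f m y - f m z - (f n y - f n z)) < e" if mn: "m \<ge> N" "n \<ge> N" for m n
        proof -
          have "c y z * (cmod (f m y - f n y - (f m z - f n z)))\<^sup>2 \<le> q (\<lambda>x. f m x - f n x)"
            using dom_energy_partial_sum[OF c dom_energy_diff[OF c f(1)[of m] f(1)[of n]],
                of "{(y, z)}"]
            by (simp add: q_def)
          also have "\<dots> < c y z * e\<^sup>2" using N mn by blast
          finally have "(cmod (f m y - f n y - (f m z - f n z)))\<^sup>2 < e\<^sup>2"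
            using pos by simp
          then have "cmod (f m y - f n y - (f m z - f n z)) < e"
            using e by (simp add: power2_less_imp_less)
          then show ?thesis by (simp add: algebra_simps)
        qed
        then show "\<exists>M. \<forall>m\<ge>M. \<forall>n\<ge>M. cmod (f m y - f m z - (f n y - f n z)) < e" by blast
      qed
      from convergent_diff[OF step.IH[unfolded Cauchy_convergent_iff] this[unfolded Cauchy_convergent_iff]]
      show ?case
        by (simp add: g_def Cauchy_convergent_iff)
    qed
  qed
  then obtain w where w: "\<And>x. (\<lambda>n. g n x) \<longlonglongrightarrow> w x"
    unfolding Cauchy_convergent_iff convergent_def by metis
  have key: "\<exists>N. \<forall>m\<ge>N. (\<lambda>x. f m x - w x) \<in> dom_energy c \<and> q (\<lambda>x. f m x - w x) \<le> e"
    if e: "e > 0" for e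
  proof -
    from C[OF e] obtain N where
      N: "\<And>m n. m \<ge> N \<Longrightarrow> n \<ge> N \<Longrightarrow> q (\<lambda>x. f m x - f n x) < e" by blast
    have "(\<Sum>(x, y)\<in>F. c x y * (cmod (f m x - w x - (f m y - w y)))\<^sup>2) \<le> e"
      if m: "m \<ge> N" and F: "finite F" for m F
    proof (rule tendsto_upperbound)
      show "(\<lambda>n. \<Sum>(x, y)\<in>F. c x y * (cmod (f m x - g n x - (f m y - g n y)))\<^sup>2)
          \<longlonglongrightarrow> (\<Sum>(x, y)\<in>F. c x y * (cmod (f m x - w x - (f m y - w y)))\<^sup>2)"
        unfolding split_beta by (intro tendsto_intros w)
      show "\<forall>\<^sub>F n in sequentially.
          (\<Sum>(x, y)\<in>F. c x y * (cmod (f m x - g n x - (f m y - g n y)))\<^sup>2) \<le> e"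
        unfolding eventually_sequentially
      proof (intro exI[of _ N] allI impI)
        fix n assume n: "n \<ge> N"
        have eq: "f m x - g n x - (f m y - g n y) = f m x - f n x - (f m y - f n y)" for x y
          by (simp add: g_def)
        show "(\<Sum>(x, y)\<in>F. c x y * (cmod (f m x - g n x - (f m y - g n y)))\<^sup>2) \<le> e"
          using dom_energy_partial_sum[OF c dom_energy_diff[OF c f(1)[of m] f(1)[of n]] F]
            N[OF m n]
          by (simp add: q_def eq)
      qed
    qed simp
    then show ?thesis
      unfolding q_def
      by (intro exI[of _ N] allI impI conjI dom_energy_bound[OF c]) auto
  qed
  obtain N where "(\<lambda>x. f N x - w x) \<in> dom_energy c"
    using key[of 1] by auto
  from dom_energy_diff[OF c f(1)[of N] this] have wd: "w \<in> dom_energy c"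
    by simp
  have "(\<lambda>n. q (\<lambda>x. f n x - w x)) \<longlonglongrightarrow> 0"
  proof (rule LIMSEQ_I)
    fix e :: real assume "e > 0"
    then have "e / 2 > 0" by simp
    from key[OF this] obtain N where "\<forall>m\<ge>N. q (\<lambda>x. f m x - w x) \<le> e / 2" by blast
    then show "\<exists>no. \<forall>n\<ge>no. norm (q (\<lambda>x. f n x - w x) - 0) < e"
      using q0 \<open>e > 0\<close> by (intro exI[of _ N]) (force simp: abs_of_nonneg)
  qed
  then have "(\<lambda>n. energy c (U n - class_of w) (U n - class_of w)) \<longlonglongrightarrow> 0"
    unfolding en by (auto intro!: tendsto_eq_intros)
  with wd show ?thesis
    unfolding energy_space_def by blast
qed

definition Harm :: "('v \<Rightarrow> 'v \<Rightarrow> real) \<Rightarrow> 'v pot set" where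
  "Harm c = {u \<in> energy_space c. \<forall>x. laplacian c u x = 0}"

definition dipole :: "('v \<Rightarrow> 'v \<Rightarrow> real) \<Rightarrow> 'v \<Rightarrow> 'v \<Rightarrow> 'v pot" where
  "dipole c r x = (THE v. v \<in> energy_space c \<and>
     (\<forall>u\<in>energy_space c. energy c v u = val_diff u x r))"

definition orth_proj :: "('v \<Rightarrow> 'v \<Rightarrow> real) \<Rightarrow> 'v pot set \<Rightarrow> 'v pot \<Rightarrow> 'v pot" where
  "orth_proj c S v = (THE p. p \<in> S \<and> (\<forall>w\<in>S. energy c w (v - p) = 0))"

definition harm_dipole :: "('v \<Rightarrow> 'v \<Rightarrow> real) \<Rightarrow> 'v \<Rightarrow> 'v \<Rightarrow> 'v pot" where
  "harm_dipole c r x = orth_proj c (Harm c) (dipole c r x)"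

subsection \<open>Boundary sums\<close>

text \<open>
  Finite subgraphs enter boundaries and normal derivatives only through their vertex sets, and
  a vertex set carries some connected subgraph iff the subgraph it induces is connected.
\<close>

definition exhaustion :: "('v \<Rightarrow> 'v \<Rightarrow> real) \<Rightarrow> (nat \<Rightarrow> 'v set) \<Rightarrow> bool" where
  "exhaustion c G \<longleftrightarrow> incseq G \<and> (\<forall>k. finite (G k) \<and> connected_verts c (G k)) \<and>
     (\<Union>k. G k) = UNIV"

definition bd :: "('v \<Rightarrow> 'v \<Rightarrow> real) \<Rightarrow> 'v set \<Rightarrow> 'v set" where
  "bd c H = {x \<in> H. \<exists>y. y \<notin> H \<and> adj c x y}"

lift_definition normal_deriv :: "('v \<Rightarrow> 'v \<Rightarrow> real) \<Rightarrow> 'v set \<Rightarrow> 'v pot \<Rightarrow> 'v \<Rightarrow> complex" is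
  "\<lambda>c H v x. \<Sum>y\<in>H. of_real (c x y) * (v x - v y)"
  by (auto simp: eq_mod_const_def)

definition has_boundary_sum ::
    "('v \<Rightarrow> 'v \<Rightarrow> real) \<Rightarrow> ('v \<Rightarrow> complex) \<Rightarrow> 'v pot \<Rightarrow> complex \<Rightarrow> bool" where
  "has_boundary_sum c u v s \<longleftrightarrow> (\<forall>G. exhaustion c G \<longrightarrow>
     (\<lambda>k. \<Sum>y\<in>bd c (G k). u y * normal_deriv c (G k) v y) \<longlonglongrightarrow> s)"

definition boundary_summable ::
    "('v \<Rightarrow> 'v \<Rightarrow> real) \<Rightarrow> ('v \<Rightarrow> complex) \<Rightarrow> 'v pot \<Rightarrow> bool" where
  "boundary_summable c u v \<longleftrightarrow> (\<exists>s. has_boundary_sum c u v s)"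

definition boundary_sum ::
    "('v \<Rightarrow> 'v \<Rightarrow> real) \<Rightarrow> ('v \<Rightarrow> complex) \<Rightarrow> 'v pot \<Rightarrow> complex" where
  "boundary_sum c u v = (THE s. has_boundary_sum c u v s)"

end

theory Submission
  imports Defs
begin

text \<open>
  For harmonic \<open>h\<close> and a finite vertex set \<open>H\<close>, the normal derivative of \<open>h\<close> vanishes in the
  interior of \<open>H\<close>, so summation by parts turns the boundary sum over \<open>bd H\<close> into the part of
  \<open>E(cnj u, h)\<close> carried by \<open>H \<times> H\<close>; absolute convergence of the energy sum gives the limit along
  every exhaustion. As \<open>cnj u\<close> is harmonic, \<open>E(cnj u, h\<^sub>x) = E(cnj u, v\<^sub>x) = u x - u r\<close>.
\<close>

subsection \<open>Riesz representation for semi-inner products\<close>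

text \<open>The discriminant argument: test with \<open>t = - s * cnj a\<close>,
  \<open>s = 1 / (N + 1)\<close>. Dividing by \<open>N + 1\<close> instead of \<open>N\<close> also
  covers \<open>N = 0\<close>, at the price of a non-sharp constant.\<close>

lemma quadratic_bound:
  fixes a :: complex and A N :: real
  assumes N: "0 \<le> N" and nonneg: "\<And>t. 0 \<le> A + 2 * Re (t * a) + (cmod t)\<^sup>2 * N"
  shows "(cmod a)\<^sup>2 \<le> (N + 1) * A"
proof -
  define s where "s = 1 / (N + 1)"
  have s: "0 < s" "s * N \<le> 1" using N by (auto simp: s_def field_simps)
  have "Re (- of_real s * cnj a * a) = - s * (cmod a)\<^sup>2"
    unfolding cmod_power2 by (simp add: power2_eq_square algebra_simps)
  then have "0 \<le> A - 2 * s * (cmod a)\<^sup>2 + (s * N) * (s * (cmod a)\<^sup>2)"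
    using nonneg[of "- of_real s * cnj a"] s
    by (simp add: norm_mult power_mult_distrib power2_eq_square algebra_simps)
  also have "(s * N) * (s * (cmod a)\<^sup>2) \<le> 1 * (s * (cmod a)\<^sup>2)"
    using s by (intro mult_right_mono) auto
  finally have "s * (cmod a)\<^sup>2 \<le> A" by simp
  then show ?thesis using N by (simp add: s_def field_simps)
qed

text \<open>The form lives on functions, not on classes, and may be degenerate: for the energy,
  constants are null vectors. It is instantiated with the finite-energy functions and with the
  harmonic ones, so that a single Riesz theorem serves both. Linearity is in the second
  argument.\<close>

locale semi_inner =
  fixes S :: "('v \<Rightarrow> complex) set" and B :: "('v \<Rightarrow> complex) \<Rightarrow> ('v \<Rightarrow> complex) \<Rightarrow> complex"
  assumes zero_mem: "(\<lambda>x. 0) \<in> S"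
    and lincomb_mem: "u \<in> S \<Longrightarrow> v \<in> S \<Longrightarrow> (\<lambda>x. u x + a * v x) \<in> S"
    and lincomb: "u \<in> S \<Longrightarrow> v \<in> S \<Longrightarrow> w \<in> S \<Longrightarrow> B w (\<lambda>x. u x + a * v x) = B w u + a * B w v"
    and hermitian: "u \<in> S \<Longrightarrow> v \<in> S \<Longrightarrow> B v u = cnj (B u v)"
    and nonneg: "u \<in> S \<Longrightarrow> 0 \<le> Re (B u u)"
begin

lemma diff_mem: "u \<in> S \<Longrightarrow> v \<in> S \<Longrightarrow> (\<lambda>x. u x - v x) \<in> S"
  using lincomb_mem[of u v "-1"] by simp

lemma diff_right:
  "u \<in> S \<Longrightarrow> v \<in> S \<Longrightarrow> w \<in> S \<Longrightarrow> B w (\<lambda>x. u x - v x) = B w u - B w v"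
  using lincomb[of u v w "-1"] by simp

lemma diff_left:
  "u \<in> S \<Longrightarrow> v \<in> S \<Longrightarrow> w \<in> S \<Longrightarrow> B (\<lambda>x. u x - v x) w = B u w - B v w"
  using hermitian[of w] diff_right[of u v w] diff_mem[of u v] by simp

lemma square_lincomb:
  assumes "u \<in> S" "w \<in> S"
  shows "Re (B (\<lambda>x. u x + a * w x) (\<lambda>x. u x + a * w x))
     = Re (B u u) + 2 * Re (a * B u w) + (cmod a)\<^sup>2 * Re (B w w)"
proof -
  let ?z = "\<lambda>x. u x + a * w x"
  have z: "?z \<in> S" by (intro lincomb_mem assms)
  have "B ?z ?z = B ?z u + a * B ?z w"
    using z assms by (intro lincomb)
  also have "B ?z u = cnj (B u u + a * B u w)"
    using hermitian[of u ?z] z assms lincomb[of u w u a] by simp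
  also have "B ?z w = cnj (cnj (B u w) + a * B w w)"
    using hermitian[of w ?z] z assms lincomb[of u w w a] hermitian[of u w] by simp
  also have "Im (B w w) = 0"
    using hermitian[of w w] assms by (metis complex_cnj_cancel_iff cnj.simps(2) neg_equal_zero)
  ultimately show ?thesis
    unfolding cmod_power2 by (simp add: algebra_simps power2_eq_square)
qed

text \<open>The sharp constant is irrelevant for its uses: for fixed \<open>w\<close>,
  \<open>B u w\<close> must tend to 0 when \<open>B u u\<close> does.\<close>

lemma weak_Cauchy_Schwarz:
  assumes "u \<in> S" "w \<in> S"
  shows "(cmod (B u w))\<^sup>2 \<le> (Re (B w w) + 1) * Re (B u u)"
proof (rule quadratic_bound)
  show "0 \<le> Re (B u u) + 2 * Re (t * B u w) + (cmod t)\<^sup>2 * Re (B w w)" for t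
    using nonneg[OF lincomb_mem[OF assms, of t]] square_lincomb[OF assms, of t] by simp
qed (use nonneg assms in auto)

text \<open>
  The representing element minimises \<open>\<parallel>w\<parallel>\<^sup>2 - 2 Re (L w)\<close>; the parallelogram law makes
  minimising sequences Cauchy.
\<close>

lemma Riesz_representation:
  fixes L :: "('v \<Rightarrow> complex) \<Rightarrow> complex"
  assumes complete: "\<And>f. (\<And>n::nat. f n \<in> S) \<Longrightarrow>
        (\<And>e. e > 0 \<Longrightarrow> \<exists>N. \<forall>m\<ge>N. \<forall>n\<ge>N. Re (B (\<lambda>x. f m x - f n x) (\<lambda>x. f m x - f n x)) < e) \<Longrightarrow>
        \<exists>p\<in>S. (\<lambda>n. Re (B (\<lambda>x. f n x - p x) (\<lambda>x. f n x - p x))) \<longlonglongrightarrow> 0"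
    and L: "\<And>u v a. u \<in> S \<Longrightarrow> v \<in> S \<Longrightarrow> L (\<lambda>x. u x + a * v x) = L u + a * L v"
    and bounded: "\<And>u. u \<in> S \<Longrightarrow> (cmod (L u))\<^sup>2 \<le> K * Re (B u u)"
  shows "\<exists>p\<in>S. \<forall>w\<in>S. B p w = L w"
proof -
  define q where "q u = Re (B u u)" for u
  define J where "J u = q u - 2 * Re (L u)" for u
  \<comment> \<open>\<open>K\<close> may be zero or negative, and the lower bound for
    \<open>J\<close> divides by it. With \<open>K' > 0\<close> it is completing the square: 2|L u|
    <= |L u|^2 / K' + K'.\<close>
  define K' where "K' = \<bar>K\<bar> + 1"
  have K': "K' > 0" by (simp add: K'_def)
  have J_lower: "- K' \<le> J u" if u: "u \<in> S" for u
  proof -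
    have "(cmod (L u))\<^sup>2 \<le> K * q u" using bounded[OF u] by (simp add: q_def)
    also have "\<dots> \<le> K' * q u"
      using nonneg[OF u] by (intro mult_right_mono) (auto simp: K'_def q_def)
    finally have "(cmod (L u))\<^sup>2 / K' \<le> q u" using K' by (simp add: field_simps)
    moreover have "0 \<le> (cmod (L u) - K')\<^sup>2 / K'" using K' by simp
    then have "2 * cmod (L u) \<le> (cmod (L u))\<^sup>2 / K' + K'"
      using K' by (simp add: power2_eq_square field_simps)
    ultimately show ?thesis
      using complex_Re_le_cmod[of "L u"] by (simp add: J_def)
  qed
  define d where "d = (INF u\<in>S. J u)"
  have bdd: "bdd_below (J ` S)" using J_lower by (auto simp: bdd_below_def)
  have d_le: "d \<le> J u" if "u \<in> S" for u
    unfolding d_def by (rule cINF_lower[OF bdd that])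
  have "\<exists>u\<in>S. J u < d + 1 / real (Suc n)" for n
  proof -
    have "Inf (J ` S) < d + 1 / real (Suc n)" by (simp add: d_def)
    then show ?thesis
      using cInf_lessD[of "J ` S" "d + 1 / real (Suc n)"] zero_mem by auto
  qed
  then obtain f where f: "\<And>n. f n \<in> S" "\<And>n. J (f n) < d + 1 / real (Suc n)"
    by metis
  \<comment> \<open>The first variation of \<open>J\<close> at \<open>u\<close> in direction
    \<open>w\<close> is governed by \<open>B u w - L w\<close>, so stationarity of \<open>J\<close>
    is the representation property.\<close>
  have Jpert: "J (\<lambda>x. u x + a * w x) = J u + 2 * Re (a * (B u w - L w)) + (cmod a)\<^sup>2 * q w"
    if "u \<in> S" "w \<in> S" for u w a
    using square_lincomb[OF that, of a] L[OF that, of a] that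
    by (simp add: J_def q_def algebra_simps)
  \<comment> \<open>Parallelogram law: expand \<open>J\<close> from \<open>u\<close> in direction
    \<open>v - u\<close>, at \<open>v\<close> and at the midpoint. Eliminating the linear term
    leaves q(u - v) = 2 J u + 2 J v - 4 J(midpoint), and the midpoint value is at least
    \<open>d\<close>.\<close>
  have par: "q (\<lambda>x. u x - v x) \<le> 2 * (J u - d) + 2 * (J v - d)" if uv: "u \<in> S" "v \<in> S" for u v
  proof -
    have w: "(\<lambda>x. v x - u x) \<in> S" using diff_mem uv by blast
    have eq: "(\<lambda>x. u x + 1 * (v x - u x)) = v" by auto
    have "J v = J u + 2 * Re (B u (\<lambda>x. v x - u x) - L (\<lambda>x. v x - u x)) + q (\<lambda>x. v x - u x)"
      using Jpert[OF uv(1) w, of 1] unfolding eq by simp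
    moreover have "d \<le> J (\<lambda>x. u x + (1/2) * (v x - u x))"
      by (intro d_le lincomb_mem uv w)
    then have "d \<le> J u + Re (B u (\<lambda>x. v x - u x) - L (\<lambda>x. v x - u x)) + q (\<lambda>x. v x - u x) / 4"
      using Jpert[OF uv(1) w, of "1/2"] by (simp add: power2_eq_square norm_divide diff_divide_distrib)
    moreover have "q (\<lambda>x. u x - v x) = q (\<lambda>x. v x - u x)"
      unfolding q_def using uv diff_mem by (simp add: diff_left diff_right)
    ultimately show ?thesis by argo
  qed
  have "\<exists>p\<in>S. (\<lambda>n. Re (B (\<lambda>x. f n x - p x) (\<lambda>x. f n x - p x))) \<longlonglongrightarrow> 0"
  proof (rule complete)
    fix e :: real assume e: "e > 0"
    obtain N where N: "1 / real (Suc N) < e / 4"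
      using e nat_approx_posE[of "e/4"] by (metis divide_pos_pos zero_less_numeral)
    have small: "J (f n) - d < e / 4" if "n \<ge> N" for n
    proof -
      have "1 / real (Suc n) \<le> 1 / real (Suc N)" using that by (simp add: field_simps)
      with f(2)[of n] N show ?thesis by linarith
    qed
    show "\<exists>N. \<forall>m\<ge>N. \<forall>n\<ge>N. Re (B (\<lambda>x. f m x - f n x) (\<lambda>x. f m x - f n x)) < e"
    proof (intro exI[of _ N] allI impI)
      fix m n assume "m \<ge> N" "n \<ge> N"
      then show "Re (B (\<lambda>x. f m x - f n x) (\<lambda>x. f m x - f n x)) < e"
        using par[OF f(1)[of m] f(1)[of n]] small[of m] small[of n] by (simp add: q_def)
    qed
  qed (rule f)
  then obtain p where p: "p \<in> S" "(\<lambda>n. q (\<lambda>x. f n x - p x)) \<longlonglongrightarrow> 0"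
    by (auto simp: q_def)
  \<comment> \<open>Stationarity is extracted from the near-minimisers \<open>f n\<close> and then
    passed to the limit, so the minimality of \<open>p\<close> itself is never established.\<close>
  have "B p w = L w" if w: "w \<in> S" for w
  proof -
    have null: "X \<longlonglongrightarrow> 0"
      if "\<And>n. (cmod (X n))\<^sup>2 \<le> (q w + 1) * Y n" "Y \<longlonglongrightarrow> 0" for X :: "nat \<Rightarrow> complex" and Y
    proof -
      have "(\<lambda>n. (q w + 1) * Y n) \<longlonglongrightarrow> 0"
        using tendsto_mult_right_zero[OF that(2)] by simp
      then have "(\<lambda>n. (cmod (X n))\<^sup>2) \<longlonglongrightarrow> 0"
        using Lim_null_comparison[of "\<lambda>n. (cmod (X n))\<^sup>2" "\<lambda>n. (q w + 1) * Y n" sequentially]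
        by (simp add: that(1))
      then have "(\<lambda>n. sqrt ((cmod (X n))\<^sup>2)) \<longlonglongrightarrow> sqrt 0" by (rule tendsto_real_sqrt)
      then show ?thesis by (simp add: tendsto_norm_zero_iff)
    qed
    have "(\<lambda>n. B (f n) w - L w) \<longlonglongrightarrow> 0"
    proof (rule null)
      \<comment> \<open>Moving from \<open>f n\<close> in any direction \<open>t * w\<close> lowers
        \<open>J\<close> by less than 1/(n+1), which is the hypothesis of
        \<open>quadratic_bound\<close> with that defect as \<open>A\<close>.\<close>
      show "(cmod (B (f n) w - L w))\<^sup>2 \<le> (q w + 1) * (1 / real (Suc n))" for n
      proof (rule quadratic_bound)
        show "0 \<le> q w" using nonneg w by (simp add: q_def)
        show "0 \<le> 1 / real (Suc n) + 2 * Re (t * (B (f n) w - L w)) + (cmod t)\<^sup>2 * q w" for t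
          using d_le[OF lincomb_mem[OF f(1) w, of n t]] Jpert[OF f(1) w, of n t] f(2)[of n]
          by linarith
      qed
      show "(\<lambda>n. 1 / real (Suc n)) \<longlonglongrightarrow> 0"
        using LIMSEQ_inverse_real_of_nat by (simp add: inverse_eq_divide)
    qed
    moreover have "(\<lambda>n. B (\<lambda>x. f n x - p x) w) \<longlonglongrightarrow> 0"
    proof (rule null[OF _ p(2)])
      show "(cmod (B (\<lambda>x. f n x - p x) w))\<^sup>2 \<le> (q w + 1) * q (\<lambda>x. f n x - p x)" for n
        using weak_Cauchy_Schwarz[OF diff_mem[OF f(1) p(1)] w, of n] by (simp add: q_def)
    qed
    ultimately have "(\<lambda>n. (B (f n) w - L w) - B (\<lambda>x. f n x - p x) w) \<longlonglongrightarrow> 0 - 0"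
      by (rule tendsto_diff)
    moreover have "(B (f n) w - L w) - B (\<lambda>x. f n x - p x) w = B p w - L w" for n
      using diff_left[OF f(1) p(1) w] by simp
    ultimately have "(\<lambda>n. B p w - L w) \<longlonglongrightarrow> 0" by simp
    then show ?thesis by (simp only: LIMSEQ_const_iff right_minus_eq)
  qed
  with p show ?thesis by blast
qed

lemma subspace:
  assumes "T \<subseteq> S" "(\<lambda>x. 0) \<in> T"
    and "\<And>u v a. u \<in> T \<Longrightarrow> v \<in> T \<Longrightarrow> (\<lambda>x. u x + a * v x) \<in> T"
  shows "semi_inner T B"
proof (rule semi_inner.intro)
  show "(\<lambda>x. 0) \<in> T" by (fact assms(2))
next
  fix u v :: "'v \<Rightarrow> complex" and a :: complex
  assume "u \<in> T" "v \<in> T"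
  then show "(\<lambda>x. u x + a * v x) \<in> T" by (rule assms(3))
next
  fix u v w :: "'v \<Rightarrow> complex" and a :: complex
  assume "u \<in> T" "v \<in> T" "w \<in> T"
  then have "u \<in> S" "v \<in> S" "w \<in> S" using assms(1) by auto
  then show "B w (\<lambda>x. u x + a * v x) = B w u + a * B w v" by (rule lincomb)
next
  fix u v :: "'v \<Rightarrow> complex"
  assume "u \<in> T" "v \<in> T"
  then have "u \<in> S" "v \<in> S" using assms(1) by auto
  then show "B v u = cnj (B u v)" by (rule hermitian)
next
  fix u :: "'v \<Rightarrow> complex"
  assume "u \<in> T"
  then have "u \<in> S" using assms(1) by auto
  then show "0 \<le> Re (B u u)" by (rule nonneg)
qed

end


subsection \<open>The energy form on functions\<close>

text \<open>Computes edge sums that involve the indicator of a vertex: only the pairs containing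
  \<open>x\<close> survive, each edge in both orientations. As \<open>x\<close> is not in
  \<open>N\<close>, the two families of pairs are disjoint.\<close>

lemma sum_over_star:
  fixes g :: "'v \<times> 'v \<Rightarrow> 'b :: {topological_comm_monoid_add, t2_space}"
  assumes "x \<notin> N"
    and zero: "\<And>a b. g (a, b) \<noteq> 0 \<Longrightarrow> a = x \<and> b \<in> N \<or> b = x \<and> a \<in> N"
    and "(\<lambda>y. g (x, y)) summable_on N" "(\<lambda>y. g (y, x)) summable_on N"
  shows "(g has_sum (infsum (\<lambda>y. g (x, y)) N + infsum (\<lambda>y. g (y, x)) N)) UNIV"
proof -
  let ?P = "(\<lambda>y. (x, y)) ` N" and ?Q = "(\<lambda>y. (y, x)) ` N"
  have "(g has_sum infsum (\<lambda>y. g (x, y)) N) ?P" "(g has_sum infsum (\<lambda>y. g (y, x)) N) ?Q"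
    using assms(3,4) by (auto simp: has_sum_reindex inj_on_def o_def)
  then have "(g has_sum (infsum (\<lambda>y. g (x, y)) N + infsum (\<lambda>y. g (y, x)) N)) (?P \<union> ?Q)"
    by (rule has_sum_Un_disjoint) (use \<open>x \<notin> N\<close> in auto)
  then show ?thesis
    by (rule has_sum_cong_neutral[THEN iffD1, rotated -1]) (use zero in force)+
qed

lemma class_of_eq_iff: "class_of u = class_of v \<longleftrightarrow> eq_mod_const u v"
  by (rule pot.abs_eq_iff)

text \<open>Finite energy depends only on differences of values, hence not on the
  representative.\<close>

lemma class_of_in_energy_space_iff: "class_of u \<in> energy_space c \<longleftrightarrow> u \<in> dom_energy c"
proof
  assume "class_of u \<in> energy_space c"
  then obtain v where v: "v \<in> dom_energy c" "eq_mod_const u v"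
    by (auto simp: energy_space_def class_of_eq_iff)
  then have "u a - u b = v a - v b" for a b
    by (auto simp: eq_mod_const_def)
  with v show "u \<in> dom_energy c" by (simp add: dom_energy_def)
qed (auto simp: energy_space_def)

locale network =
  fixes c :: "'v \<Rightarrow> 'v \<Rightarrow> real"
  assumes net: "resistance_network c"
begin

abbreviation E :: "('v \<Rightarrow> complex) \<Rightarrow> ('v \<Rightarrow> complex) \<Rightarrow> complex" where
  "E u v \<equiv> energy c (class_of u) (class_of v)"

abbreviation nbrs :: "'v \<Rightarrow> 'v set" where
  "nbrs x \<equiv> {y. adj c x y}"

lemma sym: "c x y = c y x" and nonneg: "0 \<le> c x y" and loop: "c x x = 0"
  and summable: "(\<lambda>y. c x y) summable_on nbrs x"
  and reachable: "(adj c)\<^sup>*\<^sup>* x y"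
  using net by (auto simp: resistance_network_def connected_verts_def)

lemma adj_iff: "adj c x y \<longleftrightarrow> c x y \<noteq> 0"
  using nonneg[of x y] by (auto simp: adj_def)

lemma energy_eq:
  "E u v = 1/2 * (\<Sum>\<^sub>\<infinity>(x, y)\<in>UNIV. of_real (c x y) * cnj (u x - u y) * (v x - v y))"
  by (rule energy.abs_eq)

text \<open>Comparison on each pair via ab <= a^2 + b^2 gives absolute convergence, on which all
  rearrangements and limits of the form rest.\<close>

lemma energy_summable:
  assumes "u \<in> dom_energy c" "v \<in> dom_energy c"
  shows "(\<lambda>(x, y). of_real (c x y) * cnj (u x - u y) * (v x - v y)) summable_on UNIV"
proof (rule abs_summable_summable, rule Infinite_Sum.abs_summable_on_comparison_test')
  show "(\<lambda>(x, y). c x y * (cmod (u x - u y))\<^sup>2 + c x y * (cmod (v x - v y))\<^sup>2) summable_on UNIV"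
    using summable_on_add[OF assms[unfolded dom_energy_def mem_Collect_eq]]
    by (simp add: case_prod_unfold)
  fix p :: "'v \<times> 'v"
  obtain x y where p: "p = (x, y)" by (cases p)
  have ab: "a * b \<le> a\<^sup>2 + b\<^sup>2" if "0 \<le> a" "0 \<le> b" for a b :: real
  proof -
    have "2 * (a * b) \<le> a\<^sup>2 + b\<^sup>2"
      using zero_le_power2[of "a - b"] by (simp add: power2_eq_square algebra_simps)
    moreover have "0 \<le> a * b" using that by simp
    ultimately show ?thesis by linarith
  qed
  have "c x y * (cmod (u x - u y) * cmod (v x - v y))
      \<le> c x y * ((cmod (u x - u y))\<^sup>2 + (cmod (v x - v y))\<^sup>2)"
    by (intro mult_left_mono ab nonneg) auto
  then show "norm (case p of (x, y) \<Rightarrow> of_real (c x y) * cnj (u x - u y) * (v x - v y))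
      \<le> (case p of (x, y) \<Rightarrow> c x y * (cmod (u x - u y))\<^sup>2 + c x y * (cmod (v x - v y))\<^sup>2)"
    using nonneg[of x y]
    by (simp add: p norm_mult distrib_left mult.assoc flip: complex_cnj_diff)
qed

lemma energy_self_Re: "Re (E u u) = (\<Sum>\<^sub>\<infinity>(x, y)\<in>UNIV. c x y * (cmod (u x - u y))\<^sup>2) / 2"
  by (simp add: energy_self)

lemma dom_energy_scale:
  assumes "u \<in> dom_energy c"
  shows "(\<lambda>x. a * u x) \<in> dom_energy c"
proof -
  have "(\<lambda>p. (cmod a)\<^sup>2 * (case p of (x, y) \<Rightarrow> c x y * (cmod (u x - u y))\<^sup>2)) summable_on UNIV"
    using assms by (intro summable_on_cmult_right) (simp add: dom_energy_def)
  moreover have "a * u x - a * u y = a * (u x - u y)" for x y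
    by (simp add: algebra_simps)
  ultimately show ?thesis
    by (simp add: dom_energy_def norm_mult power_mult_distrib case_prod_unfold mult_ac)
qed

sublocale energy: semi_inner "dom_energy c" E
proof
  show "(\<lambda>x. 0) \<in> dom_energy c"
    by (simp add: dom_energy_def case_prod_unfold)
  show "(\<lambda>x. u x + a * v x) \<in> dom_energy c" if "u \<in> dom_energy c" "v \<in> dom_energy c" for u v a
    using dom_energy_diff[OF nonneg that(1) dom_energy_scale[OF that(2), of "- a"]] by simp
  show "E w (\<lambda>x. u x + a * v x) = E w u + a * E w v"
    if "u \<in> dom_energy c" "v \<in> dom_energy c" "w \<in> dom_energy c" for u v w a
  proof -
    have "(\<Sum>\<^sub>\<infinity>(x, y)\<in>UNIV. of_real (c x y) * cnj (w x - w y) * ((u x + a * v x) - (u y + a * v y)))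
        = (\<Sum>\<^sub>\<infinity>p\<in>UNIV. (case p of (x, y) \<Rightarrow> of_real (c x y) * cnj (w x - w y) * (u x - u y))
            + a * (case p of (x, y) \<Rightarrow> of_real (c x y) * cnj (w x - w y) * (v x - v y)))"
      by (intro infsum_cong) (auto simp: algebra_simps)
    also have "\<dots> = (\<Sum>\<^sub>\<infinity>(x, y)\<in>UNIV. of_real (c x y) * cnj (w x - w y) * (u x - u y))
        + a * (\<Sum>\<^sub>\<infinity>(x, y)\<in>UNIV. of_real (c x y) * cnj (w x - w y) * (v x - v y))"
      unfolding infsum_cmult_right'[symmetric]
      by (intro infsum_add summable_on_cmult_right energy_summable that)
    finally show ?thesis by (simp add: energy_eq distrib_left)
  qed
  show "E v u = cnj (E u v)" for u v
    by (auto simp: energy_eq case_prod_unfold mult_ac simp flip: infsum_cnj intro!: infsum_cong)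
  show "0 \<le> Re (E u u)" for u
    unfolding energy_self_Re by (auto intro!: infsum_nonneg simp: nonneg)
qed

text \<open>Carries \<open>energy_space_complete\<close> from classes to functions;
  \<open>cmod\<close> and \<open>Re\<close> agree there because self-energies are nonnegative
  reals.\<close>

lemma dom_energy_complete:
  fixes f :: "nat \<Rightarrow> 'v \<Rightarrow> complex"
  assumes f: "\<And>n. f n \<in> dom_energy c"
    and C: "\<And>e. e > 0 \<Longrightarrow> \<exists>N. \<forall>m\<ge>N. \<forall>n\<ge>N. Re (E (\<lambda>x. f m x - f n x) (\<lambda>x. f m x - f n x)) < e"
  shows "\<exists>p\<in>dom_energy c. (\<lambda>n. Re (E (\<lambda>x. f n x - p x) (\<lambda>x. f n x - p x))) \<longlonglongrightarrow> 0"
proof -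
  have cm: "cmod (E u u) = Re (E u u)" for u
  proof -
    have "0 \<le> (\<Sum>\<^sub>\<infinity>(x, y)\<in>UNIV. c x y * (cmod (u x - u y))\<^sup>2)"
      by (auto intro!: infsum_nonneg simp: nonneg)
    then show ?thesis unfolding energy_self norm_of_real by simp
  qed
  have "\<exists>W\<in>energy_space c.
      (\<lambda>n. energy c (class_of (f n) - W) (class_of (f n) - W)) \<longlonglongrightarrow> 0"
  proof (rule energy_space_complete[OF net])
    show "class_of (f n) \<in> energy_space c" for n
      using f by (simp add: class_of_in_energy_space_iff)
    show "\<exists>N. \<forall>m\<ge>N. \<forall>n\<ge>N. cmod (energy c (class_of (f m) - class_of (f n))
        (class_of (f m) - class_of (f n))) < e" if "e > 0" for e
      unfolding minus_pot.abs_eq cm by (rule C[OF that])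
  qed
  then obtain p where p: "p \<in> dom_energy c"
    "(\<lambda>n. E (\<lambda>x. f n x - p x) (\<lambda>x. f n x - p x)) \<longlonglongrightarrow> 0"
    by (auto simp: energy_space_def minus_pot.abs_eq)
  from tendsto_Re[OF p(2)] p(1) show ?thesis by auto
qed

text \<open>Induction along a path from \<open>r\<close> to \<open>x\<close>. One edge is controlled
  by its own term in the energy; the triangle inequality |a - b|^2 <= 2|a|^2 + 2|b|^2 doubles
  \<open>K\<close>, and the factor 1/2 in the energy turns 2 / c into 4 / c.\<close>

lemma evaluation_bounded:
  "\<exists>K. \<forall>w\<in>dom_energy c. (cmod (w x - w r))\<^sup>2 \<le> K * Re (E w w)"
  using reachable[of r x]
proof induction
    case base
    then show ?case by (auto intro: exI[of _ 0])
  next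
    case (step y z)
    then obtain K where K: "\<And>w. w \<in> dom_energy c \<Longrightarrow> (cmod (w y - w r))\<^sup>2 \<le> K * Re (E w w)"
      by blast
    have pos: "c y z > 0" using step by (simp add: adj_def)
    show ?case
    proof (intro exI[of _ "2 * K + 4 / c y z"] ballI)
      fix w assume w: "w \<in> dom_energy c"
      have "c y z * (cmod (w y - w z))\<^sup>2 \<le> 2 * Re (E w w)"
        using dom_energy_partial_sum[OF nonneg w, of "{(y, z)}"] by (simp add: energy_self_Re)
      then have 1: "2 * (cmod (w y - w z))\<^sup>2 \<le> 4 / c y z * Re (E w w)"
        using pos by (simp add: field_simps)
      have "(cmod ((w y - w r) - (w y - w z)))\<^sup>2 \<le> (cmod (w y - w r) + cmod (w y - w z))\<^sup>2"
        by (intro power_mono norm_triangle_ineq4) auto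
      also have "\<dots> \<le> 2 * (cmod (w y - w r))\<^sup>2 + 2 * (cmod (w y - w z))\<^sup>2"
        using zero_le_power2[of "cmod (w y - w r) - cmod (w y - w z)"]
        by (simp add: power2_eq_square algebra_simps)
      finally show "(cmod (w z - w r))\<^sup>2 \<le> (2 * K + 4 / c y z) * Re (E w w)"
        using K[OF w] 1 by (simp add: algebra_simps)
    qed
qed

text \<open>The null vectors of the energy are exactly the constants: with zero energy,
  \<open>evaluation_bounded\<close> forces every value to equal the value at one vertex.\<close>

lemma class_of_eqI:
  assumes "u \<in> dom_energy c" "v \<in> dom_energy c"
    and "E (\<lambda>x. u x - v x) (\<lambda>x. u x - v x) = 0"
  shows "class_of u = class_of v"
proof -
  fix r :: 'v
  have "u x - v x - (u r - v r) = 0" for x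
    using evaluation_bounded[of x r] energy.diff_mem[OF assms(1,2)] assms(3) by fastforce
  then have "u x = v x + (u r - v r)" for x
    by (metis add.commute diff_add_cancel diff_eq_diff_eq right_minus_eq)
  then show ?thesis unfolding class_of_eq_iff eq_mod_const_def by blast
qed

subsection \<open>Harmonic functions\<close>

lemma laplacian_eq:
  "laplacian c (class_of u) x = (\<Sum>\<^sub>\<infinity>y\<in>nbrs x. of_real (c x y) * (u x - u y))"
  by (simp add: laplacian.abs_eq)

text \<open>Only edges at \<open>x\<close> contribute, and their conductances are summable even when
  \<open>x\<close> has infinitely many neighbours.\<close>

lemma indicator_dom: "indicator {x} \<in> dom_energy c"
proof -
  let ?g = "\<lambda>(a, b). c a b * (cmod (indicator {x} a - indicator {x} b))\<^sup>2"
  have "(?g has_sum (infsum (\<lambda>y. ?g (x, y)) (nbrs x) + infsum (\<lambda>y. ?g (y, x)) (nbrs x))) UNIV"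
  proof (rule sum_over_star)
    show "x \<notin> nbrs x" by (simp add: adj_iff loop)
    show "a = x \<and> b \<in> nbrs x \<or> b = x \<and> a \<in> nbrs x" if "?g (a, b) \<noteq> 0" for a b
      using that sym[of b a] by (cases "a = x"; cases "b = x") (auto simp: adj_iff)
    show "(\<lambda>y. ?g (x, y)) summable_on nbrs x" "(\<lambda>y. ?g (y, x)) summable_on nbrs x"
      by (rule summable_on_cong[THEN iffD1, OF _ summable[of x]],
          use loop sym in \<open>force simp: adj_iff indicator_def\<close>)+
  qed
  then show ?thesis by (auto simp: dom_energy_def summable_on_def)
qed

text \<open>The two orientations of the edges at \<open>x\<close> each contribute one copy of the
  Laplacian, which cancels the factor 1/2. Harmonicity thereby becomes orthogonality to all
  indicators, a condition stable under energy limits.\<close>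

lemma laplacian_eq_energy:
  assumes u: "u \<in> dom_energy c"
  shows "laplacian c (class_of u) x = E (indicator {x}) u"
proof -
  let ?g = "\<lambda>(a, b). of_real (c a b) * cnj (indicator {x} a - indicator {x} b) * (u a - u b)"
  have g: "?g summable_on UNIV" by (rule energy_summable[OF indicator_dom u])
  have nx: "x \<notin> nbrs x" by (simp add: adj_iff loop)
  have "(?g has_sum (infsum (\<lambda>y. ?g (x, y)) (nbrs x) + infsum (\<lambda>y. ?g (y, x)) (nbrs x))) UNIV"
  proof (rule sum_over_star[OF nx])
    show "a = x \<and> b \<in> nbrs x \<or> b = x \<and> a \<in> nbrs x" if "?g (a, b) \<noteq> 0" for a b
      using that sym[of b a] by (cases "a = x"; cases "b = x") (auto simp: adj_iff)
    have "?g summable_on (\<lambda>y. (x, y)) ` nbrs x" "?g summable_on (\<lambda>y. (y, x)) ` nbrs x"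
      using summable_on_subset_banach[OF g] by auto
    then show "(\<lambda>y. ?g (x, y)) summable_on nbrs x" "(\<lambda>y. ?g (y, x)) summable_on nbrs x"
      by (subst (asm) summable_on_reindex; simp add: inj_on_def o_def)+
  qed
  then have "infsum ?g UNIV = infsum (\<lambda>y. ?g (x, y)) (nbrs x) + infsum (\<lambda>y. ?g (y, x)) (nbrs x)"
    by (rule infsumI)
  also have "infsum (\<lambda>y. ?g (x, y)) (nbrs x) = laplacian c (class_of u) x"
    unfolding laplacian_eq by (rule infsum_cong) (use nx in \<open>auto simp: indicator_def\<close>)
  also have "infsum (\<lambda>y. ?g (y, x)) (nbrs x) = laplacian c (class_of u) x"
    unfolding laplacian_eq
    by (rule infsum_cong) (use nx sym[of _ x] in \<open>auto simp: indicator_def algebra_simps\<close>)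
  finally show ?thesis by (simp add: energy_eq)
qed

text \<open>The full preimage of \<open>Harm c\<close> among functions, the level on which the Riesz
  theorem is stated.\<close>

definition harmonic :: "('v \<Rightarrow> complex) set" where
  "harmonic = {u. class_of u \<in> Harm c}"

lemma harmonic_iff: "u \<in> harmonic \<longleftrightarrow> u \<in> dom_energy c \<and> (\<forall>x. E (indicator {x}) u = 0)"
  by (auto simp: harmonic_def Harm_def class_of_in_energy_space_iff laplacian_eq_energy)

sublocale harmonic: semi_inner harmonic E
  by (rule energy.subspace)
    (auto simp: harmonic_iff energy.lincomb_mem energy.lincomb indicator_dom energy.zero_mem
        energy_eq[of _ "\<lambda>_. 0"] case_prod_unfold)

text \<open>An orthogonal complement is closed: the energy limit \<open>p\<close> exists among
  finite-energy functions, and its pairing with an indicator is bounded by the energy of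
  \<open>f n - p\<close>.\<close>

lemma harmonic_complete:
  fixes f :: "nat \<Rightarrow> 'v \<Rightarrow> complex"
  assumes f: "\<And>n. f n \<in> harmonic"
    and C: "\<And>e. e > 0 \<Longrightarrow> \<exists>N. \<forall>m\<ge>N. \<forall>n\<ge>N. Re (E (\<lambda>x. f m x - f n x) (\<lambda>x. f m x - f n x)) < e"
  shows "\<exists>p\<in>harmonic. (\<lambda>n. Re (E (\<lambda>x. f n x - p x) (\<lambda>x. f n x - p x))) \<longlonglongrightarrow> 0"
proof -
  obtain p where p: "p \<in> dom_energy c"
    "(\<lambda>n. Re (E (\<lambda>x. f n x - p x) (\<lambda>x. f n x - p x))) \<longlonglongrightarrow> 0"
    using dom_energy_complete[OF _ C] f by (auto simp: harmonic_iff)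
  have "E (indicator {x}) p = 0" for x
  proof -
    let ?i = "indicator {x} :: 'v \<Rightarrow> complex"
    have "(cmod (E ?i p))\<^sup>2 \<le> (Re (E ?i ?i) + 1) * Re (E (\<lambda>x. f n x - p x) (\<lambda>x. f n x - p x))" for n
    proof -
      have d: "(\<lambda>x. f n x - p x) \<in> dom_energy c"
        using energy.diff_mem f p by (auto simp: harmonic_iff)
      have "E ?i (\<lambda>x. f n x - p x) = - E ?i p"
        using f p by (simp add: harmonic_iff energy.diff_right indicator_dom)
      \<comment> \<open>The arguments are swapped because \<open>weak_Cauchy_Schwarz\<close> has the
        vanishing factor first.\<close>
      then have "cmod (E (\<lambda>x. f n x - p x) ?i) = cmod (E ?i p)"
        using energy.hermitian[OF indicator_dom d] by (simp add: norm_minus_cancel)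
      then show ?thesis using energy.weak_Cauchy_Schwarz[OF d indicator_dom] by metis
    qed
    moreover have "(\<lambda>n. (Re (E ?i ?i) + 1) * Re (E (\<lambda>x. f n x - p x) (\<lambda>x. f n x - p x))) \<longlonglongrightarrow> 0"
      using tendsto_mult_right_zero[OF p(2)] by simp
    ultimately have "(cmod (E ?i p))\<^sup>2 \<le> 0"
      by (intro LIMSEQ_le_const) auto
    then show ?thesis by simp
  qed
  with p show ?thesis by (auto simp: harmonic_iff)
qed

section \<open>Dipoles and their harmonic projections\<close>

lemma dipole_exists:
  obtains d where "dipole c r x = class_of d" "d \<in> dom_energy c"
    "\<And>w. w \<in> dom_energy c \<Longrightarrow> E d w = w x - w r"
proof -
  obtain K where K: "\<And>w. w \<in> dom_energy c \<Longrightarrow> (cmod (w x - w r))\<^sup>2 \<le> K * Re (E w w)"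
    using evaluation_bounded by blast
  have "\<exists>d\<in>dom_energy c. \<forall>w\<in>dom_energy c. E d w = w x - w r"
    by (rule energy.Riesz_representation[OF dom_energy_complete _ K]) (auto simp: algebra_simps)
  then obtain d where d: "d \<in> dom_energy c" "\<And>w. w \<in> dom_energy c \<Longrightarrow> E d w = w x - w r"
    by blast
  have "dipole c r x = class_of d"
    unfolding dipole_def
  proof (rule the_equality)
    show "class_of d \<in> energy_space c \<and>
        (\<forall>u\<in>energy_space c. energy c (class_of d) u = val_diff u x r)"
      using d by (auto simp: energy_space_def val_diff.abs_eq)
    fix v assume v: "v \<in> energy_space c \<and> (\<forall>u\<in>energy_space c. energy c v u = val_diff u x r)"
    then obtain f where f: "v = class_of f" "f \<in> dom_energy c" by (auto simp: energy_space_def)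
    have "E f w = w x - w r" if "w \<in> dom_energy c" for w
      using v f that by (auto simp: energy_space_def val_diff.abs_eq)
    \<comment> \<open>Uniqueness: two representers have a difference orthogonal to every
      finite-energy function, in particular to itself.\<close>
    then have "E (\<lambda>x. f x - d x) (\<lambda>x. f x - d x) = 0"
      using f d energy.diff_mem by (simp add: energy.diff_left)
    then show "v = class_of d" using f d class_of_eqI by blast
  qed
  with d that show ?thesis by blast
qed

text \<open>
  Instead of projecting the dipole, the evaluation functional is represented on the harmonic
  functions directly; the representing element has the defining property of the projection.
\<close>

lemma harm_dipole_exists:
  obtains h where "harm_dipole c r x = class_of h" "h \<in> harmonic"
    "\<And>w. w \<in> harmonic \<Longrightarrow> E h w = w x - w r"
proof -
  obtain K where K: "\<And>w. w \<in> dom_energy c \<Longrightarrow> (cmod (w x - w r))\<^sup>2 \<le> K * Re (E w w)"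
    using evaluation_bounded by blast
  have dom: "w \<in> dom_energy c" if "w \<in> harmonic" for w using that by (simp add: harmonic_iff)
  have Harm: "Harm c = class_of ` harmonic"
    by (auto simp: harmonic_def Harm_def energy_space_def)
  obtain d where d: "dipole c r x = class_of d" "d \<in> dom_energy c"
    "\<And>w. w \<in> dom_energy c \<Longrightarrow> E d w = w x - w r"
    by (rule dipole_exists[where r = r and x = x]) (rule that)
  have "\<exists>h\<in>harmonic. \<forall>w\<in>harmonic. E h w = w x - w r"
    by (rule harmonic.Riesz_representation[OF harmonic_complete])
      (use dom K in \<open>auto simp: algebra_simps\<close>)
  then obtain h where h: "h \<in> harmonic" "\<And>w. w \<in> harmonic \<Longrightarrow> E h w = w x - w r"
    by blast
  \<comment> \<open>On harmonic \<open>w\<close>, both \<open>d\<close> and \<open>h\<close>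
    represent the same evaluation, so their difference is orthogonal to \<open>w\<close>.\<close>
  have orth: "E w (\<lambda>x. d x - h x) = 0" if w: "w \<in> harmonic" for w
    using h w d dom[OF w] dom[OF h(1)] energy.hermitian[of d w] energy.hermitian[of h w]
    by (simp add: energy.diff_right)
  have "harm_dipole c r x = class_of h"
    unfolding harm_dipole_def orth_proj_def d(1)
  proof (rule the_equality)
    show "class_of h \<in> Harm c \<and> (\<forall>w\<in>Harm c. energy c w (class_of d - class_of h) = 0)"
      using h orth by (auto simp: Harm minus_pot.abs_eq)
    fix p assume p: "p \<in> Harm c \<and> (\<forall>w\<in>Harm c. energy c w (class_of d - p) = 0)"
    then obtain f where f: "p = class_of f" "f \<in> harmonic" by (auto simp: Harm)
    \<comment> \<open>Two candidates for the projection differ by a harmonic \<open>?e\<close>.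
      Since f - h = (d - h) - (d - f) and both brackets are orthogonal to \<open>?e\<close>, its
      energy vanishes.\<close>
    let ?e = "\<lambda>x. f x - h x"
    have e: "?e \<in> harmonic" using f h harmonic.diff_mem by blast
    have "E ?e (\<lambda>x. d x - f x) = 0" using p f e by (auto simp: Harm minus_pot.abs_eq)
    then have "E ?e ?e = 0"
      using orth[OF e] dom[OF e] dom[OF f(2)] dom[OF h(1)] d(2) by (simp add: energy.diff_right)
    then show "p = class_of h" using f h dom class_of_eqI by blast
  qed
  with h that show ?thesis by blast
qed

text \<open>Conductances are real, so conjugation commutes with the Laplacian and preserves the
  energy. It is needed because the boundary sum is linear in \<open>u\<close> while \<open>E\<close>
  is antilinear in its first argument.\<close>

lemma cnj_harmonic:
  assumes "u \<in> harmonic"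
  shows "(\<lambda>x. cnj (u x)) \<in> harmonic"
proof -
  have "laplacian c (class_of (\<lambda>x. cnj (u x))) x = cnj (laplacian c (class_of u) x)" for x
    by (simp add: laplacian_eq flip: infsum_cnj)
  with assms show ?thesis
    by (simp add: harmonic_def Harm_def class_of_in_energy_space_iff dom_energy_def
        flip: complex_cnj_diff)
qed

subsection \<open>Exhaustions\<close>

text \<open>By symmetry of adjacency, any two vertices can be joined through
  \<open>r\<close>.\<close>

lemma connected_verts_iff:
  assumes "r \<in> H"
  shows "connected_verts c H \<longleftrightarrow> (\<forall>y\<in>H. (\<lambda>a b. a \<in> H \<and> b \<in> H \<and> adj c a b)\<^sup>*\<^sup>* r y)"
    (is "_ \<longleftrightarrow> (\<forall>y\<in>H. ?R\<^sup>*\<^sup>* r y)")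
proof -
  have "symp ?R" using sym by (auto simp: symp_def adj_def)
  then have "symp ?R\<^sup>*\<^sup>*" by (rule symp_rtranclp)
  then have "?R\<^sup>*\<^sup>* x y" if "\<forall>y\<in>H. ?R\<^sup>*\<^sup>* r y" "x \<in> H" "y \<in> H" for x y
    using that by (meson rtranclp_trans sympD)
  with assms show ?thesis by (auto simp: connected_verts_def)
qed

lemma connected_verts_UN:
  assumes "I \<noteq> {}" "\<And>i. i \<in> I \<Longrightarrow> r \<in> H i" "\<And>i. i \<in> I \<Longrightarrow> connected_verts c (H i)"
  shows "connected_verts c (\<Union>i\<in>I. H i)"
proof -
  have r: "r \<in> (\<Union>i\<in>I. H i)" using assms by blast
  show ?thesis
    unfolding connected_verts_iff[OF r]
  proof
    fix y assume "y \<in> (\<Union>i\<in>I. H i)"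
    then obtain i where i: "i \<in> I" "y \<in> H i" by blast
    then have "(\<lambda>a b. a \<in> H i \<and> b \<in> H i \<and> adj c a b)\<^sup>*\<^sup>* r y"
      using assms connected_verts_iff by blast
    then show "(\<lambda>a b. a \<in> (\<Union>i\<in>I. H i) \<and> b \<in> (\<Union>i\<in>I. H i) \<and> adj c a b)\<^sup>*\<^sup>* r y"
      by (rule rtranclp_mono[THEN predicate2D, rotated]) (use i in auto)
  qed
qed

text \<open>The set grows along a path from \<open>r\<close> to \<open>y\<close>, one vertex at a
  time.\<close>

lemma finite_connected_superset:
  "\<exists>H. finite H \<and> r \<in> H \<and> y \<in> H \<and> connected_verts c H"
  using reachable[of r y]
proof induction
  case base
  then show ?case by (intro exI[of _ "{r}"]) (auto simp: connected_verts_def)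
next
  case (step y z)
  then obtain H where H: "finite H" "r \<in> H" "y \<in> H" "connected_verts c H" by blast
  let ?R = "\<lambda>H a b. a \<in> H \<and> b \<in> H \<and> adj c a b"
  have ins: "r \<in> insert z H" using H by simp
  have sub: "(?R (insert z H))\<^sup>*\<^sup>* r a" if "a \<in> H" for a
  proof -
    have "(?R H)\<^sup>*\<^sup>* r a" using H that connected_verts_iff by blast
    then show ?thesis
      by (rule rtranclp_mono[THEN predicate2D, rotated]) auto
  qed
  moreover have "?R (insert z H) y z" using H step by simp
  with sub[OF \<open>y \<in> H\<close>] have "(?R (insert z H))\<^sup>*\<^sup>* r z" by (rule rtranclp.rtrancl_into_rtrancl)
  ultimately have "connected_verts c (insert z H)"
    unfolding connected_verts_iff[OF ins] by blast
  with H show ?case by (intro exI[of _ "insert z H"]) auto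
qed

text \<open>A summable family of positive reals has countable index set, so neighbourhoods are
  countable; by connectedness, walks of finite length from one vertex reach everything.\<close>

lemma countable_verts: "countable (UNIV :: 'v set)"
proof -
  fix r :: 'v
  have nbrs: "countable (nbrs x)" for x
    using summable_countable_real[OF summable[of x]] by (simp add: adj_iff)
  have "countable {y. (adj c ^^ n) r y}" for n
  proof (induction n)
    case (Suc n)
    have "{y. (adj c ^^ Suc n) r y} = (\<Union>x\<in>{y. (adj c ^^ n) r y}. nbrs x)" by auto
    then show ?case using Suc nbrs by simp
  qed simp
  then have "countable (\<Union>n. {y. (adj c ^^ n) r y})" by (intro countable_UN) auto
  also have "(\<Union>n. {y. (adj c ^^ n) r y}) = UNIV"
    using reachable[of r] by (auto simp: rtranclp_power)
  finally show ?thesis .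
qed

text \<open>Without an exhaustion, \<open>has_boundary_sum\<close> would hold vacuously for every
  value and \<open>boundary_sum\<close> would be undetermined. The sets are unions of finite
  connected sets through a common vertex \<open>r\<close>.\<close>

lemma exhaustion_exists: "\<exists>G. exhaustion c G"
proof -
  fix r :: 'v
  obtain P where P: "\<And>y. finite (P y)" "\<And>y. r \<in> P y" "\<And>y. y \<in> P y"
    "\<And>y. connected_verts c (P y)"
    using finite_connected_superset[of r] by metis
  define G where "G k = (\<Union>i\<le>k. P (from_nat_into UNIV i))" for k
  have "incseq G" by (force simp: incseq_def G_def)
  moreover have "finite (G k)" "connected_verts c (G k)" for k
    unfolding G_def using P by (auto intro!: connected_verts_UN)
  moreover have "y \<in> (\<Union>k. G k)" for y
  proof -
    have "y \<in> range (from_nat_into UNIV)"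
      using range_from_nat_into[OF _ countable_verts] by simp
    then show ?thesis using P(3) by (force simp: G_def)
  qed
  ultimately show ?thesis by (auto simp: exhaustion_def)
qed

text \<open>Every finite set of pairs is eventually swallowed by the squares, so an unordered sum
  over all pairs is the limit of its sums over them, whichever exhaustion is taken.\<close>

lemma exhaustion_filterlim:
  assumes "exhaustion c G"
  shows "filterlim (\<lambda>k. G k \<times> G k) (finite_subsets_at_top UNIV) sequentially"
  unfolding filterlim_finite_subsets_at_top
proof (intro allI impI)
  fix F :: "('v \<times> 'v) set" assume F: "finite F \<and> F \<subseteq> UNIV"
  have mono: "G i \<subseteq> G j" if "i \<le> j" for i j
    using assms that by (auto simp: exhaustion_def incseq_def)
  have "\<forall>\<^sub>F k in sequentially. p \<in> G k \<times> G k" for p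
  proof -
    obtain a b where p: "p = (a, b)" by (cases p)
    have "(\<Union>k. G k) = UNIV" using assms by (simp add: exhaustion_def)
    then obtain i j where "a \<in> G i" "b \<in> G j" by (metis UNIV_I UN_E)
    then have "a \<in> G k" "b \<in> G k" if "max i j \<le> k" for k
      using mono[of i k] mono[of j k] that by auto
    then show ?thesis
      unfolding eventually_sequentially p by blast
  qed
  then have "\<forall>\<^sub>F k in sequentially. \<forall>p\<in>F. p \<in> G k \<times> G k"
    using F by (simp add: eventually_ball_finite)
  then show "\<forall>\<^sub>F k in sequentially. finite (G k \<times> G k) \<and> F \<subseteq> G k \<times> G k \<and> G k \<times> G k \<subseteq> UNIV"
    by eventually_elim (use assms in \<open>auto simp: exhaustion_def\<close>)
qed

subsection \<open>Discrete Gauss--Green formula\<close>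

text \<open>An interior vertex has all its neighbours in \<open>H\<close>, so the sum over
  \<open>H\<close> is the whole Laplacian, padded with terms of zero conductance.\<close>

lemma normal_deriv_interior:
  assumes "finite H" "y \<in> H" "y \<notin> bd c H"
  shows "normal_deriv c H v y = laplacian c v y"
proof (induction v rule: pot.abs_induct)
  case (1 h)
  have "nbrs y \<subseteq> H" using assms by (auto simp: bd_def)
  then have "(\<Sum>z\<in>nbrs y. of_real (c y z) * (h y - h z)) = (\<Sum>z\<in>H. of_real (c y z) * (h y - h z))"
    using assms by (intro sum.mono_neutral_left) (auto simp: adj_iff)
  with \<open>nbrs y \<subseteq> H\<close> show ?case
    using assms(1) by (simp add: normal_deriv.abs_eq laplacian_eq finite_subset)
qed

lemma boundary_sum_finite:
  assumes H: "finite H" and h: "h \<in> harmonic"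
  shows "(\<Sum>y\<in>bd c H. u y * normal_deriv c H (class_of h) y)
    = 1/2 * (\<Sum>(y, z)\<in>H \<times> H. of_real (c y z) * (u y - u z) * (h y - h z))"
proof -
  define A where "A = (\<Sum>y\<in>H. \<Sum>z\<in>H. of_real (c y z) * u y * (h y - h z))"
  have "(\<Sum>y\<in>bd c H. u y * normal_deriv c H (class_of h) y)
      = (\<Sum>y\<in>H. u y * normal_deriv c H (class_of h) y)"
    by (rule sum.mono_neutral_left[OF H])
      (use h in \<open>auto simp: bd_def normal_deriv_interior[OF H] harmonic_def Harm_def\<close>)
  also have "\<dots> = A"
    by (simp add: A_def normal_deriv.abs_eq sum_distrib_left mult_ac)
  finally have 1: "(\<Sum>y\<in>bd c H. u y * normal_deriv c H (class_of h) y) = A" .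
  \<comment> \<open>Antisymmetrisation: exchanging the names \<open>y\<close> and \<open>z\<close>
    flips the sign of the difference of \<open>h\<close>, so \<open>A\<close> is also minus the sum
    weighted by \<open>u z\<close>. Adding both forms gives the symmetric expression for
    \<open>2 * A\<close>.\<close>
  have "A = (\<Sum>z\<in>H. \<Sum>y\<in>H. of_real (c y z) * u y * (h y - h z))"
    unfolding A_def by (rule sum.swap)
  also have "\<dots> = - (\<Sum>y\<in>H. \<Sum>z\<in>H. of_real (c y z) * u z * (h y - h z))"
    unfolding sum_negf[symmetric]
    by (intro sum.cong refl) (simp add: sym algebra_simps)
  finally have "2 * A = A - (\<Sum>y\<in>H. \<Sum>z\<in>H. of_real (c y z) * u z * (h y - h z))" by simp
  also have "\<dots> = (\<Sum>(y, z)\<in>H \<times> H. of_real (c y z) * (u y - u z) * (h y - h z))"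
    by (simp add: A_def algebra_simps flip: sum.cartesian_product sum_subtractf)
  finally have 2: "2 * A = (\<Sum>(y, z)\<in>H \<times> H. of_real (c y z) * (u y - u z) * (h y - h z))" .
  show ?thesis unfolding 1 2[symmetric] by simp
qed

text \<open>Only \<open>h\<close> has to be harmonic; \<open>u\<close> just needs finite energy, so
  that the edge sum converges absolutely. Conjugating \<open>u\<close> undoes the conjugation in the
  first slot of \<open>E\<close>.\<close>

lemma has_boundary_sum_energy:
  assumes u: "u \<in> dom_energy c" and h: "h \<in> harmonic"
  shows "has_boundary_sum c u (class_of h) (E (\<lambda>x. cnj (u x)) h)"
  unfolding has_boundary_sum_def
proof (intro allI impI)
  fix G assume G: "exhaustion c G"
  let ?f = "\<lambda>(y, z). of_real (c y z) * (u y - u z) * (h y - h z)"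
  have cu: "(\<lambda>x. cnj (u x)) \<in> dom_energy c"
    using u by (simp add: dom_energy_def flip: complex_cnj_diff)
  have eq: "?f = (\<lambda>(y, z). of_real (c y z) * cnj (cnj (u y) - cnj (u z)) * (h y - h z))"
    by (simp add: fun_eq_iff)
  have "?f summable_on UNIV"
    unfolding eq using energy_summable[OF cu] h by (simp add: harmonic_iff)
  then have "(sum ?f \<longlongrightarrow> infsum ?f UNIV) (finite_subsets_at_top UNIV)"
    by (rule infsum_tendsto)
  from filterlim_compose[OF this exhaustion_filterlim[OF G]]
  have "(\<lambda>k. 1/2 * sum ?f (G k \<times> G k)) \<longlonglongrightarrow> 1/2 * infsum ?f UNIV"
    by (intro tendsto_mult_left) (simp add: o_def)
  also have "1/2 * infsum ?f UNIV = E (\<lambda>x. cnj (u x)) h"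
    unfolding energy_eq eq ..
  finally have lim: "(\<lambda>k. 1/2 * sum ?f (G k \<times> G k)) \<longlonglongrightarrow> E (\<lambda>x. cnj (u x)) h" .
  have "finite (G k)" for k using G by (simp add: exhaustion_def)
  from lim show "(\<lambda>k. \<Sum>y\<in>bd c (G k). u y * normal_deriv c (G k) (class_of h) y)
      \<longlonglongrightarrow> E (\<lambda>x. cnj (u x)) h"
    unfolding boundary_sum_finite[OF \<open>finite (G _)\<close> h] .
qed

lemma boundary_sum_eqI:
  assumes "has_boundary_sum c u v s"
  shows "boundary_sum c u v = s"
proof -
  obtain G where "exhaustion c G" using exhaustion_exists by blast
  then show ?thesis
    unfolding boundary_sum_def
    using assms by (intro the_equality) (auto simp: has_boundary_sum_def intro: LIMSEQ_unique)
qed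

end

theorem corollary3p13:
  fixes c :: "'v \<Rightarrow> 'v \<Rightarrow> real" and r x :: 'v and u :: "'v \<Rightarrow> complex"
  assumes "resistance_network c"
    and "class_of u \<in> Harm c"
  shows "boundary_summable c u (harm_dipole c r x) \<and>
         u x = boundary_sum c u (harm_dipole c r x) + u r"
proof -
  interpret network c by (rule network.intro) (rule assms)
  obtain h where h: "harm_dipole c r x = class_of h" "h \<in> harmonic"
    "\<And>w. w \<in> harmonic \<Longrightarrow> E h w = w x - w r"
    by (rule harm_dipole_exists[where r = r and x = x]) (rule that)
  have u: "u \<in> harmonic" using assms by (simp add: harmonic_def)
  \<comment> \<open>Hermitian symmetry brings \<open>h\<close> to the first slot, where it
    reproduces the values of \<open>cnj u\<close>; the outer conjugation then restores
    \<open>u\<close>.\<close>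
  have "E (\<lambda>x. cnj (u x)) h = cnj (E h (\<lambda>x. cnj (u x)))"
    using h(2) cnj_harmonic[OF u] by (intro harmonic.hermitian)
  also have "\<dots> = u x - u r"
    using h(3)[OF cnj_harmonic[OF u]] by simp
  finally have "has_boundary_sum c u (class_of h) (u x - u r)"
    using has_boundary_sum_energy[OF _ h(2), of u] u by (simp add: harmonic_iff)
  then show ?thesis
    unfolding h(1) boundary_summable_def using boundary_sum_eqI by fastforce
qed

end
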